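(* For any integers $m,n>1$, the SFT $Y_{\mathcal{S}_0}$ on $BS(m,n)$ contains a weakly periodic configuration $y$ with period $p=bab^{-1}aba^{-1}b^{-1}a^{-1}$; that is, $p\neq e$ in $BS(m,n)$ and $p\cdot y=y$.
   Context: $BS(m,n)=\langle a,b \mid b a^{m} b^{-1} = a^n\rangle$, with identity $e$. It acts on configurations $x\in\mathcal{A}^{BS(m,n)}$ by $(g\cdot x)_h=x_{g^{-1}h}$; $x$ is weakly periodic if its stabilizer is not $\{e\}$. Wang tiles. A Wang tile of $BS(m,n)$ is a tuple $s=(t_1,\dots,t_m,l,r,b_1,\dots,b_n)$ of colors, with $s(\text{top}_k)=t_k$, $s(\text{left})=l$, $s(\text{right})=r$, $s(\text{bottom}_j)=b_j$. For a finite tileset $\tau$, $X^\tau$ is the set of $T\in\tau^{BS(m,n)}$ such that for all $g$, all $1\le k\le m$ and $1\le j\le n$: $T_g(\text{right})=T_{ga^m}(\text{left})$ and $T_g(\text{top}_k)=T_{ga^{k-j}b}(\text{bottom}_j)$. The tilesets $\tau_{q,I}$. The height $\|g\|_b$ of $g$ is the number of $b$'s minus the number of $b^{-1}$'s in any word representing $g$. Define $\alpha$ on words over $\{a,b,a^{-1},b^{-1}\}$ by $\alpha(\epsilon)=0$ for the empty word, $\alpha(wb)=\alpha(wb^{-1})=\alpha(w)$, $\alpha(wa)=\alpha(w)+(n/m)^{\|w\|_b}$, $\alpha(wa^{-1})=\alpha(w)-(n/m)^{\|w\|_b}$; this induces a well-defined map $\alpha:BS(m,n)\to\mathbb{R}$.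 Let $\lambda(g)=\frac1m\left(\frac mn\right)^{\|g\|_b}\alpha(g)$. For $q\in\mathbb{Q}$, $g\in BS(m,n)$, $x\in\mathbb{R}$ put $t_j(g,x)=\lfloor(m\lambda(g)+j)x\rfloor-\lfloor(m\lambda(g)+j-1)x\rfloor$ for $1\le j\le m$, $b_j(g,x)=\lfloor(n\lambda(g)+j)qx\rfloor-\lfloor(n\lambda(g)+j-1)qx\rfloor$ for $1\le j\le n$, $l(g,x)=\frac qm\lfloor m\lambda(g)x\rfloor-\frac1n\lfloor n\lambda(g)qx\rfloor$, $r(g,x)=\frac qm\lfloor(m\lambda(g)+m)x\rfloor-\frac1n\lfloor(n\lambda(g)+n)qx\rfloor$, and let $\tau_{q,I}$ be the set of all tiles $(t_1(g,x),\dots,t_m(g,x),l(g,x),r(g,x),b_1(g,x),\dots,b_n(g,x))$ with $g\in BS(m,n)$, $x\in I$. The SFT $Y_{\mathcal{S}_0}$. It encodes the system $\mathcal{S}_0=\{f_1,f_2\}$, $f_1:[\frac13,1]\to[\frac23,2]$, $x\mapsto2x$, and $f_2:[1,2]\to[\frac13,\frac23]$, $x\mapsto\frac13x$. Let $\tau$ be the (finite) set of tiles $(t_1,\dots,t_m,(l,i),(r,i),b_1,\dots,b_n)$ with $i\in\{1,2\}$ and $(t_1,\dots,t_m,l,r,b_1,\dots,b_n)$ in $\tau_{2,[0,1]}$ if $i=1$, in $\tau_{1/3,[1,2]}$ if $i=2$; such a tile is said to have color $i$. $Y_{\mathcal{S}_0}$ is the set of $T\in X^\tau$ such that, whenever $T_g$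 has color $1$, every $3$ consecutive terms of the sequence $(T_{ga^{j}}(\text{top}_1))_{j\in\mathbb{Z}}$ of labels on the upper side of the line of $g$ contain at least one label $1$. *)

theory Defs
  imports Complex_Main "HOL-Algebra.Group_Action" "HOL-Library.FuncSet"
begin

section \<open>The Baumslag-Solitar group \<open>BS(m,n)\<close>\<close>

datatype letter = Pos_a | Neg_a | Pos_b | Neg_b

fun inv_letter :: "letter \<Rightarrow> letter" where
  "inv_letter Pos_a = Neg_a"
| "inv_letter Neg_a = Pos_a"
| "inv_letter Pos_b = Neg_b"
| "inv_letter Neg_b = Pos_b"

text \<open>Two words are related iff they represent the same element of
  \<open>\<langle>a, b | b a^m b^-1 = a^n\<rangle>\<close>.\<close>

inductive bs_eq :: "nat \<Rightarrow> nat \<Rightarrow> letter list \<Rightarrow> letter list \<Rightarrow> bool" for m n where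
  refl: "bs_eq m n w w"
| sym: "bs_eq m n v w \<Longrightarrow> bs_eq m n w v"
| trans: "bs_eq m n u v \<Longrightarrow> bs_eq m n v w \<Longrightarrow> bs_eq m n u w"
| cancel: "bs_eq m n (u @ [x, inv_letter x] @ v) (u @ v)"
| relator: "bs_eq m n (u @ [Pos_b] @ replicate m Pos_a @ [Neg_b] @ v) (u @ replicate n Pos_a @ v)"

definition bs_class :: "nat \<Rightarrow> nat \<Rightarrow> letter list \<Rightarrow> letter list set" where
  "bs_class m n w = {v. bs_eq m n w v}"

definition BS :: "nat \<Rightarrow> nat \<Rightarrow> letter list set monoid" where
  "BS m n = \<lparr> carrier = range (bs_class m n),
              mult = (\<lambda>X Y. \<Union>u\<in>X. \<Union>v\<in>Y. bs_class m n (u @ v)),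
              one = bs_class m n [] \<rparr>"

abbreviation bs_a :: "nat \<Rightarrow> nat \<Rightarrow> letter list set" where
  "bs_a m n \<equiv> bs_class m n [Pos_a]"

abbreviation bs_b :: "nat \<Rightarrow> nat \<Rightarrow> letter list set" where
  "bs_b m n \<equiv> bs_class m n [Pos_b]"

lemma bs_eq_append_left: "bs_eq m n v w \<Longrightarrow> bs_eq m n (u @ v) (u @ w)"
proof (induction rule: bs_eq.induct)
  case (cancel u' x v) show ?case using bs_eq.cancel[of m n "u @ u'" x v] by simp
next
  case (relator u' v) show ?case using bs_eq.relator[of m n "u @ u'" v] by simp
qed (blast intro: bs_eq.intros)+

lemma bs_eq_append_right: "bs_eq m n v w \<Longrightarrow> bs_eq m n (v @ u) (w @ u)"
proof (induction rule: bs_eq.induct)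
  case (cancel u' x v) show ?case using bs_eq.cancel[of m n u' x "v @ u"] by simp
next
  case (relator u' v) show ?case using bs_eq.relator[of m n u' "v @ u"] by simp
qed (blast intro: bs_eq.intros)+

lemma bs_eq_append: "bs_eq m n u u' \<Longrightarrow> bs_eq m n v v' \<Longrightarrow> bs_eq m n (u @ v) (u' @ v')"
  by (meson bs_eq.trans bs_eq_append_left bs_eq_append_right)

lemma bs_class_eq_iff: "bs_class m n u = bs_class m n v \<longleftrightarrow> bs_eq m n u v"
  unfolding bs_class_def by (blast intro: bs_eq.intros)

lemma self_in_bs_class: "w \<in> bs_class m n w"
  unfolding bs_class_def by (simp add: bs_eq.refl)

lemma carrier_BS: "carrier (BS m n) = range (bs_class m n)"
  by (simp add: BS_def)

lemma one_BS: "\<one>\<^bsub>BS m n\<^esub> = bs_class m n []"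
  by (simp add: BS_def)

lemma mult_BS: "bs_class m n u \<otimes>\<^bsub>BS m n\<^esub> bs_class m n v = bs_class m n (u @ v)"
proof -
  have "bs_class m n (u' @ v') = bs_class m n (u @ v)"
    if "u' \<in> bs_class m n u" "v' \<in> bs_class m n v" for u' v'
    using that unfolding bs_class_eq_iff
    by (auto simp: bs_class_def intro: bs_eq_append bs_eq.sym)
  then have "(\<Union>u'\<in>bs_class m n u. \<Union>v'\<in>bs_class m n v. bs_class m n (u' @ v'))
      = (\<Union>u'\<in>bs_class m n u. \<Union>v'\<in>bs_class m n v. bs_class m n (u @ v))"
    by auto
  also have "\<dots> = bs_class m n (u @ v)"
    using self_in_bs_class by blast
  finally show ?thesis by (simp add: BS_def)
qed

lemma bs_eq_inverse: "bs_eq m n (map inv_letter (rev w) @ w) []"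
proof (induction w)
  case Nil show ?case by (simp add: bs_eq.refl)
next
  case (Cons x w)
  have "inv_letter (inv_letter x) = x" by (cases x) auto
  then have "bs_eq m n (map inv_letter (rev (x # w)) @ x # w) (map inv_letter (rev w) @ w)"
    using bs_eq.cancel[of m n "map inv_letter (rev w)" "inv_letter x" w] by simp
  with Cons show ?case by (blast intro: bs_eq.trans)
qed

lemma group_BS: "group (BS m n)"
proof (rule groupI)
  fix X assume "X \<in> carrier (BS m n)"
  then obtain w where w: "X = bs_class m n w" by (auto simp: carrier_BS)
  show "\<exists>Y\<in>carrier (BS m n). Y \<otimes>\<^bsub>BS m n\<^esub> X = \<one>\<^bsub>BS m n\<^esub>"
    by (rule bexI[of _ "bs_class m n (map inv_letter (rev w))"])
      (auto simp: w mult_BS one_BS bs_class_eq_iff carrier_BS bs_eq_inverse)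
qed (auto simp: carrier_BS mult_BS one_BS)


section \<open>Configurations, action and weak periodicity\<close>

text \<open>Configurations on \<open>G\<close> are extensional functions on \<open>carrier G\<close>, so that \<open>=\<close> is
  equality of configurations.\<close>

definition shift :: "('g, 'z) monoid_scheme \<Rightarrow> 'g \<Rightarrow> ('g \<Rightarrow> 's) \<Rightarrow> 'g \<Rightarrow> 's" where
  "shift G g x = (\<lambda>h\<in>carrier G. x (inv\<^bsub>G\<^esub> g \<otimes>\<^bsub>G\<^esub> h))"

definition weakly_periodic :: "('g, 'z) monoid_scheme \<Rightarrow> ('g \<Rightarrow> 's) \<Rightarrow> bool" where
  "weakly_periodic G x \<longleftrightarrow> stabilizer G (shift G) x \<noteq> {\<one>\<^bsub>G\<^esub>}"


definition bs_period :: "nat \<Rightarrow> nat \<Rightarrow> letter list set" where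
  "bs_period m n = bs_class m n [Pos_b, Pos_a, Neg_b, Pos_a, Pos_b, Neg_a, Neg_b, Neg_a]"


section \<open>Wang tiles\<close>

text \<open>The tuple \<open>(t_1,...,t_m,l,r,b_1,...,b_n)\<close> is \<open>Tile [t_1,...,t_m] l r [b_1,...,b_n]\<close>.\<close>

datatype ('h, 'v) wang_tile =
  Tile (tops: "'h list") (left: 'v) (right: 'v) (bottoms: "'h list")

definition tile_top :: "('h, 'v) wang_tile \<Rightarrow> nat \<Rightarrow> 'h" where
  "tile_top s k = tops s ! (k - 1)"

definition tile_bottom :: "('h, 'v) wang_tile \<Rightarrow> nat \<Rightarrow> 'h" where
  "tile_bottom s j = bottoms s ! (j - 1)"

definition tilings ::
    "nat \<Rightarrow> nat \<Rightarrow> ('h, 'v) wang_tile set \<Rightarrow> (letter list set \<Rightarrow> ('h, 'v) wang_tile) set" where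
  "tilings m n \<tau> = {T \<in> carrier (BS m n) \<rightarrow>\<^sub>E \<tau>.
     \<forall>g\<in>carrier (BS m n). \<forall>k\<in>{1..m}. \<forall>j\<in>{1..n}.
       right (T g) = left (T (g \<otimes>\<^bsub>BS m n\<^esub> bs_a m n [^]\<^bsub>BS m n\<^esub> m)) \<and>
       tile_top (T g) k =
         tile_bottom (T (g \<otimes>\<^bsub>BS m n\<^esub> bs_a m n [^]\<^bsub>BS m n\<^esub> (int k - int j) \<otimes>\<^bsub>BS m n\<^esub> bs_b m n)) j}"


section \<open>The functions \<open>\<alpha>\<close> and \<open>\<lambda>\<close>\<close>

definition word_height :: "letter list \<Rightarrow> int" where
  "word_height w = int (count_list w Pos_b) - int (count_list w Neg_b)"

function word_alpha :: "nat \<Rightarrow> nat \<Rightarrow> letter list \<Rightarrow> real" where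
  "word_alpha m n [] = 0"
| "word_alpha m n (w @ [Pos_b]) = word_alpha m n w"
| "word_alpha m n (w @ [Neg_b]) = word_alpha m n w"
| "word_alpha m n (w @ [Pos_a]) = word_alpha m n w + (real n / real m) powi word_height w"
| "word_alpha m n (w @ [Neg_a]) = word_alpha m n w - (real n / real m) powi word_height w"
  by (auto, metis rev_exhaust letter.exhaust)
termination by (relation "measure (\<lambda>(m, n, w). length w)") auto

text \<open>All words in the class \<open>g\<close> have the same height and (for \<open>m, n > 0\<close>) the same value of
  \<open>\<alpha>\<close>; see \<open>height_bs_class\<close> and \<open>alpha_bs_class\<close> below.\<close>

definition height :: "letter list set \<Rightarrow> int" where
  "height g = the_elem (word_height ` g)"

definition alpha :: "nat \<Rightarrow> nat \<Rightarrow> letter list set \<Rightarrow> real" where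
  "alpha m n g = the_elem (word_alpha m n ` g)"

lemma word_height_append [simp]: "word_height (u @ v) = word_height u + word_height v"
  by (simp add: word_height_def)

lemma word_height_replicate_a [simp]: "word_height (replicate k Pos_a) = 0"
  by (induction k) (auto simp: word_height_def)

lemma word_height_bs_eq: "bs_eq m n v w \<Longrightarrow> word_height v = word_height w"
proof (induction rule: bs_eq.induct)
  case (cancel u x v) show ?case by (cases x) (auto simp: word_height_def)
next
  case (relator u v)
  have "word_height [Pos_b] = 1" "word_height [Neg_b] = -1" by (auto simp: word_height_def)
  then show ?case by (simp del: append_Cons)
qed auto

lemma height_bs_class: "height (bs_class m n w) = word_height w"
proof -
  have "word_height ` bs_class m n w = {word_height w}"
    using word_height_bs_eq self_in_bs_class by (fastforce simp: bs_class_def intro: bs_eq.refl)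
  then show ?thesis by (simp add: height_def)
qed

lemma word_alpha_single:
  "word_alpha m n [Pos_b] = 0" "word_alpha m n [Neg_b] = 0"
  "word_alpha m n [Pos_a] = 1" "word_alpha m n [Neg_a] = -1"
  using word_alpha.simps(2-5)[of m n "[]"] by (auto simp: word_height_def)

lemma word_alpha_append:
  assumes "m > 0" "n > 0"
  shows "word_alpha m n (u @ v) = word_alpha m n u + (real n / real m) powi word_height u * word_alpha m n v"
proof (induction v rule: rev_induct)
  case (snoc x v)
  have nz: "real n / real m \<noteq> 0" using assms by simp
  show ?case
    using snoc nz word_alpha.simps(2-5)[of m n "u @ v"]
    by (cases x) (auto simp: power_int_add algebra_simps)
qed simp

lemma word_alpha_replicate_a: "word_alpha m n (replicate k Pos_a) = real k"
proof (induction k)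
  case (Suc k)
  have "replicate (Suc k) Pos_a = replicate k Pos_a @ [Pos_a]"
    by (simp add: replicate_append_same)
  with Suc show ?case by (simp del: replicate.simps)
qed simp

lemma word_alpha_bs_eq:
  assumes "m > 0" "n > 0" "bs_eq m n v w"
  shows "word_alpha m n v = word_alpha m n w"
  using assms(3)
proof (induction rule: bs_eq.induct)
  case (cancel u x v)
  have nz: "real n / real m \<noteq> 0" using assms by simp
  have *: "word_alpha m n [x, inv_letter x] = 0" "word_height [x, inv_letter x] = 0"
    using word_alpha_append[OF assms(1,2), of "[x]" "[inv_letter x]"]
    by (cases x; auto simp: word_alpha_single word_height_def)+
  show ?case
    unfolding word_alpha_append[OF assms(1,2)] * by simp
next
  case (relator u v)
  have h: "word_height [Pos_b] = 1" "word_height [Neg_b] = -1" by (auto simp: word_height_def)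
  show ?case
    unfolding word_alpha_append[OF assms(1,2)] using assms
    by (simp add: word_alpha_single word_alpha_replicate_a h field_simps)
qed auto

lemma alpha_bs_class:
  assumes "m > 0" "n > 0"
  shows "alpha m n (bs_class m n w) = word_alpha m n w"
proof -
  have "word_alpha m n ` bs_class m n w = {word_alpha m n w}"
    using word_alpha_bs_eq[OF assms] self_in_bs_class
    by (fastforce simp: bs_class_def intro: bs_eq.refl)
  then show ?thesis by (simp add: alpha_def)
qed

definition lam :: "nat \<Rightarrow> nat \<Rightarrow> letter list set \<Rightarrow> real" where
  "lam m n g = 1 / real m * (real m / real n) powi height g * alpha m n g"


section \<open>The tilesets \<open>\<tau>\<^bsub>q,I\<^esub>\<close>\<close>

definition top_label :: "nat \<Rightarrow> nat \<Rightarrow> letter list set \<Rightarrow> real \<Rightarrow> nat \<Rightarrow> int" where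
  "top_label m n g x j =
     \<lfloor>(real m * lam m n g + real j) * x\<rfloor> - \<lfloor>(real m * lam m n g + real j - 1) * x\<rfloor>"

definition bottom_label :: "nat \<Rightarrow> nat \<Rightarrow> rat \<Rightarrow> letter list set \<Rightarrow> real \<Rightarrow> nat \<Rightarrow> int" where
  "bottom_label m n q g x j =
     \<lfloor>(real n * lam m n g + real j) * of_rat q * x\<rfloor>
     - \<lfloor>(real n * lam m n g + real j - 1) * of_rat q * x\<rfloor>"

definition left_label :: "nat \<Rightarrow> nat \<Rightarrow> rat \<Rightarrow> letter list set \<Rightarrow> real \<Rightarrow> rat" where
  "left_label m n q g x =
     q / of_nat m * of_int \<lfloor>real m * lam m n g * x\<rfloor>
     - 1 / of_nat n * of_int \<lfloor>real n * lam m n g * of_rat q * x\<rfloor>"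

definition right_label :: "nat \<Rightarrow> nat \<Rightarrow> rat \<Rightarrow> letter list set \<Rightarrow> real \<Rightarrow> rat" where
  "right_label m n q g x =
     q / of_nat m * of_int \<lfloor>(real m * lam m n g + real m) * x\<rfloor>
     - 1 / of_nat n * of_int \<lfloor>(real n * lam m n g + real n) * of_rat q * x\<rfloor>"

definition mult_tile :: "nat \<Rightarrow> nat \<Rightarrow> rat \<Rightarrow> letter list set \<Rightarrow> real \<Rightarrow> (int, rat) wang_tile" where
  "mult_tile m n q g x =
     Tile (map (top_label m n g x) [1..<m+1]) (left_label m n q g x)
       (right_label m n q g x) (map (bottom_label m n q g x) [1..<n+1])"

definition mult_tileset :: "nat \<Rightarrow> nat \<Rightarrow> rat \<Rightarrow> real set \<Rightarrow> (int, rat) wang_tile set" where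
  "mult_tileset m n q I = {mult_tile m n q g x |g x. g \<in> carrier (BS m n) \<and> x \<in> I}"


section \<open>The subshift \<open>Y\<^bsub>S\<^sub>0\<^esub>\<close>\<close>

definition S0_tileset :: "nat \<Rightarrow> nat \<Rightarrow> (int, rat \<times> nat) wang_tile set" where
  "S0_tileset m n =
     {Tile ts (l, i) (r, i) bs |ts l r bs i.
        i = 1 \<and> Tile ts l r bs \<in> mult_tileset m n 2 {0..1} \<or>
        i = 2 \<and> Tile ts l r bs \<in> mult_tileset m n (1/3) {1..2}}"

text \<open>On tiles of \<open>S0_tileset\<close> the indices on the left and right sides agree.\<close>

definition tile_color :: "(int, rat \<times> nat) wang_tile \<Rightarrow> nat" where
  "tile_color s = snd (left s)"

definition Y_S0 :: "nat \<Rightarrow> nat \<Rightarrow> (letter list set \<Rightarrow> (int, rat \<times> nat) wang_tile) set" where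
  "Y_S0 m n = {T \<in> tilings m n (S0_tileset m n).
     \<forall>g\<in>carrier (BS m n). tile_color (T g) = 1 \<longrightarrow>
       (\<forall>j::int. \<exists>i\<in>{j..j+2}.
          tile_top (T (g \<otimes>\<^bsub>BS m n\<^esub> bs_a m n [^]\<^bsub>BS m n\<^esub> i)) 1 = 1)}"

end

theory Submission
  imports Defs
begin

text \<open>The piecewise map \<open>x \<mapsto> 2x\<close> on \<open>[1/3,1)\<close>, \<open>x \<mapsto> x/3\<close> on \<open>[1,2)\<close> is a bijection of \<open>[1/3,2)\<close>, so
  the orbit of \<open>1\<close> is biinfinite. Putting at \<open>g\<close> the multiplication tile of \<open>g\<close> for the orbit point
  of index \<open>\<parallel>g\<parallel>\<^sub>b\<close> gives a tiling whose value at \<open>g\<close> depends on \<open>\<parallel>g\<parallel>\<^sub>b\<close> and \<open>\<alpha>(g)\<close> only. The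
  period \<open>p\<close> is the commutator of \<open>bab\<^sup>-\<^sup>1\<close> and \<open>a\<close>, and has \<open>\<parallel>p\<parallel>\<^sub>b = 0\<close> and \<open>\<alpha>(p) = 0\<close>, hence fixes
  the tiling. To see \<open>p \<noteq> e\<close>, let \<open>BS(m,n)\<close> act on \<open>\<int> \<times> \<nat>\<close> with \<open>a\<close> the unit translation of the first
  coordinate: \<open>a\<^sup>m\<close> and \<open>a\<^sup>n\<close> both have countably many orbits, all of them infinite, so \<open>b\<close> may
  be any bijection matching them up equivariantly, and one can be chosen for which \<open>bab\<^sup>-\<^sup>1\<close> and \<open>a\<close>
  do not commute.\<close>

section \<open>Nontriviality of the period\<close>

fun word_act :: "(letter \<Rightarrow> 'x \<Rightarrow> 'x) \<Rightarrow> letter list \<Rightarrow> 'x \<Rightarrow> 'x" where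
  "word_act \<phi> [] = id"
| "word_act \<phi> (l # w) = \<phi> l \<circ> word_act \<phi> w"

lemma word_act_append: "word_act \<phi> (u @ v) = word_act \<phi> u \<circ> word_act \<phi> v"
  by (induction u) (auto simp: comp_assoc)

lemma word_act_replicate: "word_act \<phi> (replicate k l) = \<phi> l ^^ k"
  by (induction k) auto

text \<open>Letter maps satisfying the defining relations give an action of the group: a cancelling
  pair acts as the identity, and \<open>b a^m b^-1\<close> acts as
  \<open>a^n b b^-1\<close>.\<close>

lemma word_act_bs_eq:
  assumes "bs_eq m n v w"
    and inv: "\<And>l. \<phi> l \<circ> \<phi> (inv_letter l) = id"
    and rel: "\<phi> Pos_b \<circ> (\<phi> Pos_a ^^ m) = (\<phi> Pos_a ^^ n) \<circ> \<phi> Pos_b"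
  shows "word_act \<phi> v = word_act \<phi> w"
  using assms(1)
proof (induction rule: bs_eq.induct)
  case (cancel u x v)
  have "word_act \<phi> [x, inv_letter x] = id"
    using inv[of x] by simp
  then show ?case
    by (simp only: word_act_append comp_id id_comp)
next
  case (relator u v)
  have "word_act \<phi> ([Pos_b] @ replicate m Pos_a @ [Neg_b])
      = \<phi> Pos_b \<circ> (\<phi> Pos_a ^^ m) \<circ> \<phi> Neg_b"
    by (simp add: word_act_append word_act_replicate comp_assoc del: append_Cons)
  also have "\<dots> = (\<phi> Pos_a ^^ n) \<circ> (\<phi> Pos_b \<circ> \<phi> (inv_letter Pos_b))"
    by (simp add: rel comp_assoc)
  also have "\<dots> = word_act \<phi> (replicate n Pos_a)"
    by (simp only: inv comp_id word_act_replicate)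
  finally show ?case
    by (simp add: word_act_append comp_assoc[symmetric] del: append_Cons)
qed auto

text \<open>\<open>orbit_coords k\<close> conjugates the \<open>k\<close>-th power of the unit translation to the unit
  translation.\<close>

definition orbit_coords :: "nat \<Rightarrow> int \<times> nat \<Rightarrow> int \<times> nat" where
  "orbit_coords k = (\<lambda>(z, i). (z div int k, k * i + nat (z mod int k)))"

definition orbit_coords_inv :: "nat \<Rightarrow> int \<times> nat \<Rightarrow> int \<times> nat" where
  "orbit_coords_inv k = (\<lambda>(z, i). (int k * z + int (i mod k), i div k))"

text \<open>The swap makes \<open>b a b\<^sup>-\<^sup>1\<close> fail to commute with \<open>a\<close> also when \<open>m = n\<close>.\<close>

definition swap01 :: "int \<times> nat \<Rightarrow> int \<times> nat" where
  "swap01 = (\<lambda>(z, i). (z, if i = 0 then 1 else if i = 1 then 0 else i))"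

definition translate :: "int \<Rightarrow> int \<times> nat \<Rightarrow> int \<times> nat" where
  "translate c = (\<lambda>(z, i). (z + c, i))"

fun bs_action :: "nat \<Rightarrow> nat \<Rightarrow> letter \<Rightarrow> int \<times> nat \<Rightarrow> int \<times> nat" where
  "bs_action m n Pos_a = translate 1"
| "bs_action m n Neg_a = translate (-1)"
| "bs_action m n Pos_b = orbit_coords_inv n \<circ> swap01 \<circ> orbit_coords m"
| "bs_action m n Neg_b = orbit_coords_inv m \<circ> swap01 \<circ> orbit_coords n"

lemma orbit_coords_inverse:
  assumes "k > 0"
  shows "orbit_coords k (orbit_coords_inv k x) = x" "orbit_coords_inv k (orbit_coords k x) = x"
proof -
  obtain z i where x: "x = (z, i)" by fastforce
  have "(int k * z + int (i mod k)) div int k = z" "(int k * z + int (i mod k)) mod int k = int (i mod k)"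
    using assms by (auto simp: div_pos_pos_trivial)
  then show "orbit_coords k (orbit_coords_inv k x) = x"
    by (simp add: x orbit_coords_def orbit_coords_inv_def)
  have "nat (z mod int k) < k"
    using assms by (simp add: nat_less_iff)
  then show "orbit_coords_inv k (orbit_coords k x) = x"
    using assms by (simp add: x orbit_coords_def orbit_coords_inv_def)
qed

lemma swap01_involution: "swap01 (swap01 x) = x"
  by (cases x) (simp add: swap01_def)

lemma translate_funpow: "translate c ^^ k = translate (int k * c)"
  by (induction k) (auto simp: translate_def fun_eq_iff algebra_simps)

lemma orbit_coords_translate:
  "k > 0 \<Longrightarrow> orbit_coords k (translate (int k) x) = translate 1 (orbit_coords k x)"
  by (cases x) (simp add: orbit_coords_def translate_def)

lemma orbit_coords_inv_translate:
  "orbit_coords_inv k (translate 1 x) = translate (int k) (orbit_coords_inv k x)"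
  by (cases x) (simp add: orbit_coords_inv_def translate_def algebra_simps)

lemma swap01_translate: "swap01 (translate c x) = translate c (swap01 x)"
  by (cases x) (simp add: swap01_def translate_def)

lemma bs_action_inverse:
  assumes "m > 0" "n > 0"
  shows "bs_action m n l \<circ> bs_action m n (inv_letter l) = id"
  using assms
  by (cases l) (auto simp: fun_eq_iff translate_def orbit_coords_inverse swap01_involution)

text \<open>In the coordinates \<open>orbit_coords m\<close>, \<open>a^m\<close> is the unit
  translation; it commutes with the swap, and \<open>orbit_coords_inv n\<close> turns it into
  \<open>a^n\<close>.\<close>

lemma bs_action_relation:
  assumes "m > 0" "n > 0"
  shows "bs_action m n Pos_b \<circ> (bs_action m n Pos_a ^^ m)
      = (bs_action m n Pos_a ^^ n) \<circ> bs_action m n Pos_b"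
  using assms
  by (simp add: fun_eq_iff translate_funpow orbit_coords_translate orbit_coords_inv_translate
      swap01_translate)

lemma bs_period_neq_one:
  assumes "m > 1" "n > 1"
  shows "bs_period m n \<noteq> \<one>\<^bsub>BS m n\<^esub>"
proof
  let ?A = "bs_action m n Pos_a" and ?B = "bs_action m n Pos_b" and ?B' = "bs_action m n Neg_b"
  let ?w = "[Pos_b, Pos_a, Neg_b, Pos_a, Pos_b, Neg_a, Neg_b, Neg_a]"
  have inv: "bs_action m n l (bs_action m n (inv_letter l) x) = x" for l x
    using fun_cong[OF bs_action_inverse[of m n l], of x] assms by (simp del: bs_action.simps)
  assume "bs_period m n = \<one>\<^bsub>BS m n\<^esub>"
  then have "bs_eq m n ?w []"
    by (simp add: bs_period_def one_BS bs_class_eq_iff)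
  then have "word_act (bs_action m n) ?w = word_act (bs_action m n) []"
    by (rule word_act_bs_eq[OF _ bs_action_inverse bs_action_relation]) (use assms in simp_all)
  \<comment> \<open>The last four letters of \<open>p\<close> undo \<open>a b a b^-1\<close>, so
    \<open>p = e\<close> forces \<open>b a b^-1\<close> and \<open>a\<close> to commute at
    \<open>(0, 0)\<close>.\<close>
  then have "word_act (bs_action m n) ?w (?A (?B (?A (?B' (0, 0))))) = ?A (?B (?A (?B' (0, 0))))"
    by simp
  then have "?B (?A (?B' (?A (0, 0)))) = ?A (?B (?A (?B' (0, 0))))"
    using inv[of Neg_a] inv[of Neg_b] inv[of Pos_b] by (simp del: bs_action.simps)
  moreover have "fst (?B (?A (?B' (?A (0, 0))))) = 0"
    using assms by (simp add: translate_def orbit_coords_def orbit_coords_inv_def swap01_def)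
  moreover have "fst (?A (?B (?A (?B' (0, 0))))) > 0"
  \<comment> \<open>\<open>b^-1\<close> and then \<open>a\<close> lead from \<open>(0, 0)\<close> to
    \<open>(2, 0)\<close>. For \<open>m = 2\<close> the coordinate 2 opens a new block of length
    \<open>m\<close>; otherwise its residue is 2, which the swap fixes.\<close>
  proof (cases "m = 2")
    case True
    then show ?thesis
      using assms by (simp add: translate_def orbit_coords_def orbit_coords_inv_def swap01_def)
  next
    case False
    then have "(2 :: int) div int m = 0" "(2 :: int) mod int m = 2"
      using assms by auto
    moreover have "int (2 mod n) + 1 > 0"
      by linarith
    ultimately show ?thesis
      using assms by (simp add: translate_def orbit_coords_def orbit_coords_inv_def swap01_def)
  qed
  ultimately show False
    by simp
qed


section \<open>Positions along lines\<close>

lemma BS_class_cases: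
  assumes "g \<in> carrier (BS m n)"
  obtains w where "g = bs_class m n w"
  using assms by (auto simp: carrier_BS)

lemma bs_class_in_carrier [simp]: "bs_class m n w \<in> carrier (BS m n)"
  by (simp add: carrier_BS)

lemma height_mult:
  assumes "g \<in> carrier (BS m n)" "h \<in> carrier (BS m n)"
  shows "height (g \<otimes>\<^bsub>BS m n\<^esub> h) = height g + height h"
  using assms by (auto elim!: BS_class_cases simp: mult_BS height_bs_class)

text \<open>The \<open>a\<close>-steps of \<open>h\<close> are taken at heights raised by
  \<open>height g\<close>, hence the factor.\<close>

lemma alpha_mult:
  assumes "m > 0" "n > 0" "g \<in> carrier (BS m n)" "h \<in> carrier (BS m n)"
  shows "alpha m n (g \<otimes>\<^bsub>BS m n\<^esub> h)
    = alpha m n g + (real n / real m) powi height g * alpha m n h"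
  using assms
  by (auto elim!: BS_class_cases
      simp: mult_BS height_bs_class alpha_bs_class word_alpha_append)

lemma height_one: "height \<one>\<^bsub>BS m n\<^esub> = 0"
  by (simp add: one_BS height_bs_class word_height_def)

lemma alpha_one: "m > 0 \<Longrightarrow> n > 0 \<Longrightarrow> alpha m n \<one>\<^bsub>BS m n\<^esub> = 0"
  by (simp add: one_BS alpha_bs_class)

lemma height_alpha_inv:
  assumes "m > 0" "n > 0" "g \<in> carrier (BS m n)" "height g = 0"
  shows "height (inv\<^bsub>BS m n\<^esub> g) = 0" "alpha m n (inv\<^bsub>BS m n\<^esub> g) = - alpha m n g"
proof -
  interpret group "BS m n" by (rule group_BS)
  have "g \<otimes>\<^bsub>BS m n\<^esub> inv\<^bsub>BS m n\<^esub> g = \<one>\<^bsub>BS m n\<^esub>"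
    using assms by simp
  then show "height (inv\<^bsub>BS m n\<^esub> g) = 0" "alpha m n (inv\<^bsub>BS m n\<^esub> g) = - alpha m n g"
    using assms height_mult[of g m n "inv\<^bsub>BS m n\<^esub> g"] alpha_mult[of m n g "inv\<^bsub>BS m n\<^esub> g"]
    by (auto simp: height_one alpha_one)
qed

lemma height_alpha_pow_a:
  assumes "m > 0" "n > 0"
  shows "height (bs_a m n [^]\<^bsub>BS m n\<^esub> (k::nat)) = 0 \<and> alpha m n (bs_a m n [^]\<^bsub>BS m n\<^esub> k) = real k"
proof -
  interpret group "BS m n" by (rule group_BS)
  show ?thesis
    using assms
    by (induction k)
      (auto simp: height_one alpha_one height_mult alpha_mult height_bs_class alpha_bs_class
        word_alpha_single word_height_def)
qed

lemma height_alpha_int_pow_a: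
  assumes "m > 0" "n > 0"
  shows "height (bs_a m n [^]\<^bsub>BS m n\<^esub> (i::int)) = 0" "alpha m n (bs_a m n [^]\<^bsub>BS m n\<^esub> i) = real_of_int i"
proof -
  interpret group "BS m n" by (rule group_BS)
  let ?a = "\<lambda>k::nat. bs_a m n [^]\<^bsub>BS m n\<^esub> k"
  have a: "?a k \<in> carrier (BS m n)" "height (?a k) = 0" "alpha m n (?a k) = real k" for k
    using height_alpha_pow_a[OF assms, of k] by (simp_all only: nat_pow_closed bs_class_in_carrier)
  have "height (bs_a m n [^]\<^bsub>BS m n\<^esub> i) = 0 \<and> alpha m n (bs_a m n [^]\<^bsub>BS m n\<^esub> i) = real_of_int i"
  proof (cases i rule: int_cases2)
    case (nonneg k)
    then show ?thesis
      by (simp only: int_pow_int a of_int_of_nat_eq)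
  next
    case (nonpos k)
    then show ?thesis
      by (simp only: int_pow_neg_int[OF bs_class_in_carrier] height_alpha_inv[OF assms a(1,2)] a(3)
          of_int_minus of_int_of_nat_eq)
  qed
  then show "height (bs_a m n [^]\<^bsub>BS m n\<^esub> i) = 0" "alpha m n (bs_a m n [^]\<^bsub>BS m n\<^esub> i) = real_of_int i"
    by (simp_all only:)
qed

text \<open>The power of \<open>m/n\<close> in \<open>lam\<close> undoes the scaling of
  \<open>a\<close>-steps in \<open>alpha\<close>, so \<open>m * lam\<close> is a coordinate along
  the line of \<open>g\<close> in which \<open>a\<close> is a unit step.\<close>

lemma lam_mult_int_pow_a:
  assumes "m > 0" "n > 0" "g \<in> carrier (BS m n)"
  shows "real m * lam m n (g \<otimes>\<^bsub>BS m n\<^esub> bs_a m n [^]\<^bsub>BS m n\<^esub> (i::int)) = real m * lam m n g + real_of_int i"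
    and "height (g \<otimes>\<^bsub>BS m n\<^esub> bs_a m n [^]\<^bsub>BS m n\<^esub> i) = height g"
proof -
  interpret group "BS m n" by (rule group_BS)
  have "(real m / real n) powi k * (real n / real m) powi k = 1" for k
    using assms by (simp flip: power_int_mult_distrib)
  then show "real m * lam m n (g \<otimes>\<^bsub>BS m n\<^esub> bs_a m n [^]\<^bsub>BS m n\<^esub> i) = real m * lam m n g + real_of_int i"
    using assms
    by (simp add: lam_def height_mult alpha_mult height_alpha_int_pow_a algebra_simps)
  show "height (g \<otimes>\<^bsub>BS m n\<^esub> bs_a m n [^]\<^bsub>BS m n\<^esub> i) = height g"
    using assms by (simp add: height_mult height_alpha_int_pow_a)
qed

text \<open>\<open>b\<close> keeps \<open>alpha\<close> and adds one factor \<open>m/n\<close> to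
  \<open>lam\<close>. Thus the lower side at \<open>g b\<close> is indexed from the same position as
  the upper side at \<open>g\<close>.\<close>

lemma lam_mult_b:
  assumes "m > 0" "n > 0" "g \<in> carrier (BS m n)"
  shows "real n * lam m n (g \<otimes>\<^bsub>BS m n\<^esub> bs_b m n) = real m * lam m n g"
    and "height (g \<otimes>\<^bsub>BS m n\<^esub> bs_b m n) = height g + 1"
proof -
  have h: "height (bs_b m n) = 1" "alpha m n (bs_b m n) = 0"
    using assms by (auto simp: height_bs_class alpha_bs_class word_alpha_single word_height_def)
  then show "real n * lam m n (g \<otimes>\<^bsub>BS m n\<^esub> bs_b m n) = real m * lam m n g"
    using assms by (simp add: lam_def height_mult alpha_mult power_int_add field_simps)
  show "height (g \<otimes>\<^bsub>BS m n\<^esub> bs_b m n) = height g + 1"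
    using assms h by (simp add: height_mult)
qed


section \<open>A biinfinite orbit\<close>

text \<open>At 1, where both maps of the system apply, the branch \<open>x / 3\<close> is taken, so
  the value 2 never occurs.\<close>

definition step :: "real \<Rightarrow> real" where
  "step x = (if x < 1 then 2 * x else x / 3)"

text \<open>The cut \<open>2/3\<close> separates the images \<open>[1/3, 2/3)\<close> and
  \<open>[2/3, 2)\<close> of the two branches.\<close>

definition step_back :: "real \<Rightarrow> real" where
  "step_back x = (if x < 2/3 then 3 * x else x / 2)"

lemma step_range: "x \<in> {1/3..<2} \<Longrightarrow> step x \<in> {1/3..<2}"
  and step_back_range: "x \<in> {1/3..<2} \<Longrightarrow> step_back x \<in> {1/3..<2}"
  and step_step_back: "x \<in> {1/3..<2} \<Longrightarrow> step (step_back x) = x"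
  by (auto simp: step_def step_back_def)

text \<open>The index is the height, which increases against the direction of the dynamics.\<close>

definition orbit_point :: "int \<Rightarrow> real" where
  "orbit_point h = (if h \<le> 0 then (step ^^ nat (-h)) 1 else (step_back ^^ nat h) 1)"

lemma orbit_point_range: "orbit_point h \<in> {1/3..<2}"
proof -
  have "(step ^^ k) 1 \<in> {1/3..<2}" "(step_back ^^ k) 1 \<in> {1/3..<2}" for k
    by (induction k) (use step_range step_back_range in auto)
  then show ?thesis
    by (simp only: orbit_point_def split: if_split) blast
qed

lemma step_orbit_point: "step (orbit_point (h + 1)) = orbit_point h"
proof (cases "h \<ge> 0")
  case True
  then have "orbit_point (h + 1) = step_back (orbit_point h)"
    by (auto simp: orbit_point_def nat_add_distrib)
  then show ?thesis
    using step_step_back orbit_point_range by simp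
next
  case False
  \<comment> \<open>Below height 0, going down by one means one more forward iteration.\<close>
  then have "nat (-h) = Suc (nat (- (h + 1)))"
    by simp
  with False show ?thesis
    by (simp add: orbit_point_def)
qed

definition orbit_color :: "int \<Rightarrow> nat" where
  "orbit_color h = (if orbit_point h < 1 then 1 else 2)"

definition orbit_factor :: "int \<Rightarrow> rat" where
  "orbit_factor h = (if orbit_point h < 1 then 2 else 1/3)"

text \<open>This lets the lower labels at height \<open>h + 1\<close> encode the same real number as
  the upper labels at height \<open>h\<close>.\<close>

lemma orbit_factor_mult: "of_rat (orbit_factor (h + 1)) * orbit_point (h + 1) = orbit_point h"
  using step_orbit_point[of h] by (auto simp: orbit_factor_def step_def of_rat_divide)


section \<open>The periodic configuration\<close>

definition orbit_tile :: "nat \<Rightarrow> nat \<Rightarrow> letter list set \<Rightarrow> (int, rat \<times> nat) wang_tile" where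
  "orbit_tile m n g =
    (let h = height g; s = mult_tile m n (orbit_factor h) g (orbit_point h)
     in Tile (tops s) (left s, orbit_color h) (right s, orbit_color h) (bottoms s))"

lemma mult_tile_in_mult_tileset:
  "g \<in> carrier (BS m n) \<Longrightarrow> x \<in> I \<Longrightarrow> mult_tile m n q g x \<in> mult_tileset m n q I"
  by (auto simp: mult_tileset_def)

lemma orbit_tile_in_S0_tileset:
  assumes "g \<in> carrier (BS m n)"
  shows "orbit_tile m n g \<in> S0_tileset m n"
proof -
  let ?s = "mult_tile m n (orbit_factor (height g)) g (orbit_point (height g))"
  have "orbit_color (height g) = 1 \<and> ?s \<in> mult_tileset m n 2 {0..1}
      \<or> orbit_color (height g) = 2 \<and> ?s \<in> mult_tileset m n (1/3) {1..2}"
  proof (cases "orbit_point (height g) < 1")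
    case True
    then show ?thesis
      using orbit_point_range[of "height g"] mult_tile_in_mult_tileset[OF assms]
      by (simp add: orbit_factor_def orbit_color_def)
  next
    case False
    then show ?thesis
      using orbit_point_range[of "height g"] mult_tile_in_mult_tileset[OF assms]
      by (simp add: orbit_factor_def orbit_color_def)
  qed
  then have "\<exists>ts l r bs i. orbit_tile m n g = Tile ts (l, i) (r, i) bs \<and>
      (i = 1 \<and> Tile ts l r bs \<in> mult_tileset m n 2 {0..1} \<or>
       i = 2 \<and> Tile ts l r bs \<in> mult_tileset m n (1/3) {1..2})"
    by (intro exI[of _ "tops ?s"] exI[of _ "left ?s"] exI[of _ "right ?s"] exI[of _ "bottoms ?s"]
        exI[of _ "orbit_color (height g)"])
      (simp only: orbit_tile_def Let_def wang_tile.collapse)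
  then show ?thesis
    unfolding S0_tileset_def by blast
qed

section \<open>Edge labels and matching rules\<close>

lemma nth_map_upt_from_1: "k \<in> {1..m} \<Longrightarrow> map f [1..<m + 1] ! (k - 1) = f k"
  by (subst nth_map_upt) auto

lemma tile_top_orbit_tile:
  "k \<in> {1..m} \<Longrightarrow> tile_top (orbit_tile m n g) k = top_label m n g (orbit_point (height g)) k"
  by (simp only: tile_top_def orbit_tile_def Let_def mult_tile_def wang_tile.sel nth_map_upt_from_1)

lemma tile_bottom_orbit_tile:
  "j \<in> {1..n} \<Longrightarrow> tile_bottom (orbit_tile m n g) j =
    bottom_label m n (orbit_factor (height g)) g (orbit_point (height g)) j"
  by (simp only: tile_bottom_def orbit_tile_def Let_def mult_tile_def wang_tile.sel
      nth_map_upt_from_1)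

text \<open>Passing to \<open>g a^m\<close> raises \<open>lam\<close> by one and keeps the height,
  so both labels take floors at the same arguments and carry the same color.\<close>

lemma orbit_tile_horizontal:
  assumes "m > 0" "n > 0" "g \<in> carrier (BS m n)"
  shows "right (orbit_tile m n g)
    = left (orbit_tile m n (g \<otimes>\<^bsub>BS m n\<^esub> bs_a m n [^]\<^bsub>BS m n\<^esub> m))"
proof -
  interpret group "BS m n" by (rule group_BS)
  let ?g = "g \<otimes>\<^bsub>BS m n\<^esub> bs_a m n [^]\<^bsub>BS m n\<^esub> m"
  have g: "height ?g = height g" "real m * lam m n ?g = real m * lam m n g + real m"
    using lam_mult_int_pow_a[OF assms, of "int m"] by (simp_all add: int_pow_int)
  then have "real m * (lam m n ?g - lam m n g - 1) = 0"
    by (simp add: algebra_simps)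
  then have "lam m n ?g = lam m n g + 1"
    using assms by simp
  then show ?thesis
    by (simp only: orbit_tile_def Let_def mult_tile_def wang_tile.sel left_label_def
        right_label_def g(1) distrib_left mult_1_right)
qed

lemma orbit_tile_vertical:
  assumes "m > 0" "n > 0" "g \<in> carrier (BS m n)" "k \<in> {1..m}" "j \<in> {1..n}"
  shows "tile_top (orbit_tile m n g) k = tile_bottom (orbit_tile m n
    (g \<otimes>\<^bsub>BS m n\<^esub> bs_a m n [^]\<^bsub>BS m n\<^esub> (int k - int j) \<otimes>\<^bsub>BS m n\<^esub> bs_b m n)) j"
proof -
  interpret group "BS m n" by (rule group_BS)
  let ?g' = "g \<otimes>\<^bsub>BS m n\<^esub> bs_a m n [^]\<^bsub>BS m n\<^esub> (int k - int j)"
  let ?g = "?g' \<otimes>\<^bsub>BS m n\<^esub> bs_b m n"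
  have g': "?g' \<in> carrier (BS m n)"
    using assms by simp
  have h: "height ?g = height g + 1"
    using lam_mult_int_pow_a(2)[OF assms(1-3)] lam_mult_b(2)[OF assms(1,2) g'] by simp
  \<comment> \<open>Hence \<open>n * lam + j\<close> at \<open>g a^(k-j) b\<close> equals
    \<open>m * lam + k\<close> at \<open>g\<close>: lower label \<open>j\<close> and upper label
    \<open>k\<close> sit at the same position.\<close>
  have l: "real n * lam m n ?g = real m * lam m n g + (real k - real j)"
    using lam_mult_int_pow_a(1)[OF assms(1-3), of "int k - int j"]
      lam_mult_b(1)[OF assms(1,2) g'] by simp
  have x: "c * of_rat (orbit_factor (height g + 1)) * orbit_point (height g + 1)
      = c * orbit_point (height g)" for c :: real
    by (simp add: orbit_factor_mult mult.assoc)
  show ?thesis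
    unfolding tile_top_orbit_tile[OF assms(4)] tile_bottom_orbit_tile[OF assms(5)]
      top_label_def bottom_label_def h l x by simp
qed

section \<open>The condition on lines of color 1\<close>

lemma tile_color_orbit_tile: "tile_color (orbit_tile m n g) = orbit_color (height g)"
  by (simp add: tile_color_def orbit_tile_def Let_def)

text \<open>Labels are at most \<open>1\<close> for \<open>x \<le> 1\<close>, and three consecutive ones telescope to
  \<open>\<lfloor>y + 3x\<rfloor> - \<lfloor>y\<rfloor> \<ge> 1\<close> for \<open>x \<ge> 1/3\<close>.\<close>

lemma three_labels_contain_one:
  fixes c x :: real
  assumes "1/3 \<le> x" "x \<le> 1"
  shows "\<exists>i\<in>{j..j+2::int}. \<lfloor>(c + real_of_int i + 1) * x\<rfloor> - \<lfloor>(c + real_of_int i) * x\<rfloor> = 1"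
proof (rule ccontr)
  assume none: "\<not> ?thesis"
  define y where "y = (c + real_of_int j) * x"
  have e: "(c + real_of_int j) * x = y" "(c + real_of_int j + 1) * x = y + x"
    "(c + real_of_int (j + 1)) * x = y + x" "(c + real_of_int (j + 1) + 1) * x = y + 2 * x"
    "(c + real_of_int (j + 2)) * x = y + 2 * x" "(c + real_of_int (j + 2) + 1) * x = y + 3 * x"
    by (simp_all add: y_def algebra_simps)
  have "\<lfloor>(c + real_of_int i + 1) * x\<rfloor> - \<lfloor>(c + real_of_int i) * x\<rfloor> \<noteq> 1"
    if "i \<in> {j..j+2}" for i
    using none that by blast
  from this[of j] this[of "j + 1"] this[of "j + 2"]
  have "\<lfloor>y + x\<rfloor> - \<lfloor>y\<rfloor> \<noteq> 1" "\<lfloor>y + 2 * x\<rfloor> - \<lfloor>y + x\<rfloor> \<noteq> 1" "\<lfloor>y + 3 * x\<rfloor> - \<lfloor>y + 2 * x\<rfloor> \<noteq> 1"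
    unfolding e by simp_all
  moreover have "\<lfloor>y + x\<rfloor> \<le> \<lfloor>y\<rfloor> + 1" "\<lfloor>y + 2 * x\<rfloor> \<le> \<lfloor>y + x\<rfloor> + 1" "\<lfloor>y + 3 * x\<rfloor> \<le> \<lfloor>y + 2 * x\<rfloor> + 1"
    "\<lfloor>y + 3 * x\<rfloor> \<ge> \<lfloor>y\<rfloor> + 1"
    using assms by linarith+
  ultimately show False
    by linarith
qed

lemma orbit_tile_color_one:
  assumes "m > 0" "n > 0" "g \<in> carrier (BS m n)" "tile_color (orbit_tile m n g) = 1"
  shows "\<exists>i\<in>{j..j+2}. tile_top (orbit_tile m n
    (g \<otimes>\<^bsub>BS m n\<^esub> bs_a m n [^]\<^bsub>BS m n\<^esub> (i::int))) 1 = 1"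
proof -
  have "orbit_point (height g) \<le> 1"
    using assms(4) by (auto simp: tile_color_orbit_tile orbit_color_def split: if_splits)
  then have "\<exists>i\<in>{j..j+2}.
      \<lfloor>(real m * lam m n g + real_of_int i + 1) * orbit_point (height g)\<rfloor>
      - \<lfloor>(real m * lam m n g + real_of_int i) * orbit_point (height g)\<rfloor> = 1"
    using orbit_point_range[of "height g"] by (intro three_labels_contain_one) auto
  then show ?thesis
    using assms by (simp add: tile_top_orbit_tile top_label_def lam_mult_int_pow_a)
qed

section \<open>The tiling and its period\<close>

definition orbit_tiling :: "nat \<Rightarrow> nat \<Rightarrow> letter list set \<Rightarrow> (int, rat \<times> nat) wang_tile" where
  "orbit_tiling m n = restrict (orbit_tile m n) (carrier (BS m n))"

lemma orbit_tiling_in_Y_S0: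
  assumes "m > 0" "n > 0"
  shows "orbit_tiling m n \<in> Y_S0 m n"
proof -
  interpret group "BS m n" by (rule group_BS)
  have "orbit_tiling m n \<in> tilings m n (S0_tileset m n)"
    unfolding tilings_def orbit_tiling_def
    using assms by (auto simp: orbit_tile_in_S0_tileset orbit_tile_horizontal orbit_tile_vertical)
  then show ?thesis
    unfolding Y_S0_def orbit_tiling_def using assms orbit_tile_color_one by simp
qed

text \<open>The inverse of \<open>g\<close> also has height 0 and \<open>alpha\<close> 0, so left
  multiplication by it preserves both quantities, and the tile depends on nothing else.\<close>

lemma shift_orbit_tiling:
  assumes "m > 0" "n > 0" "g \<in> carrier (BS m n)" "height g = 0" "alpha m n g = 0"
  shows "shift (BS m n) g (orbit_tiling m n) = orbit_tiling m n"
proof -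
  interpret group "BS m n" by (rule group_BS)
  have "orbit_tile m n (inv\<^bsub>BS m n\<^esub> g \<otimes>\<^bsub>BS m n\<^esub> h) = orbit_tile m n h"
    if h: "h \<in> carrier (BS m n)" for h
  proof -
    have "height (inv\<^bsub>BS m n\<^esub> g \<otimes>\<^bsub>BS m n\<^esub> h) = height h"
      "alpha m n (inv\<^bsub>BS m n\<^esub> g \<otimes>\<^bsub>BS m n\<^esub> h) = alpha m n h"
      using assms h by (simp_all add: height_mult alpha_mult height_alpha_inv)
    then show ?thesis
      by (simp add: orbit_tile_def mult_tile_def left_label_def right_label_def
          top_label_def[abs_def] bottom_label_def[abs_def] lam_def)
  qed
  with assms show ?thesis
    by (auto simp: shift_def orbit_tiling_def fun_eq_iff restrict_def)
qed

lemma height_alpha_bs_period: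
  assumes "m > 0" "n > 0"
  shows "height (bs_period m n) = 0" "alpha m n (bs_period m n) = 0"
proof -
  show "height (bs_period m n) = 0"
    by (simp add: bs_period_def height_bs_class word_height_def)
  \<comment> \<open>\<open>word_alpha\<close> recurses from the right end; peeling letters from the
    left evaluates the literal word. Its \<open>a\<close>-steps contribute
    \<open>n/m + 1 - n/m - 1\<close>.\<close>
  have "word_alpha m n (x # y # w) = word_alpha m n [x]
      + (real n / real m) powi word_height [x] * word_alpha m n (y # w)" for x y w
    using word_alpha_append[OF assms, of "[x]" "y # w"] by simp
  then show "alpha m n (bs_period m n) = 0"
    using assms
    by (simp add: bs_period_def alpha_bs_class word_alpha_single word_height_def field_simps)
qed

theorem proposition2p10:
  fixes m n :: nat
  assumes "m > 1" and "n > 1"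
  shows "\<exists>y \<in> Y_S0 m n. weakly_periodic (BS m n) y \<and>
           bs_period m n \<noteq> \<one>\<^bsub>BS m n\<^esub> \<and> shift (BS m n) (bs_period m n) y = y"
proof (intro bexI conjI)
  have p: "bs_period m n \<in> carrier (BS m n)"
    by (simp add: bs_period_def)
  show ne: "bs_period m n \<noteq> \<one>\<^bsub>BS m n\<^esub>"
    using assms by (rule bs_period_neq_one)
  show fix_p: "shift (BS m n) (bs_period m n) (orbit_tiling m n) = orbit_tiling m n"
    using assms p by (intro shift_orbit_tiling height_alpha_bs_period) auto
  show "weakly_periodic (BS m n) (orbit_tiling m n)"
    using p ne fix_p by (auto simp: weakly_periodic_def stabilizer_def)
  show "orbit_tiling m n \<in> Y_S0 m n"
    using assms by (intro orbit_tiling_in_Y_S0) auto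
qed

end
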